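(* There exist an absolute constant $C>0$ and an integer $n_0\ge 3$ such that for every integer $n\ge n_0$ and every continuous MHR distribution $F$, $$\mathrm{APX}(F,n)=\frac{\mathrm{Myerson}(F,n)}{\mathrm{Price}(F,n)}\le 1+C\,\frac{\ln\ln n}{\ln n}.$$ That is, using the same take-it-or-leave-it price to sell an item to $n$ buyers with i.i.d. valuations from a continuous MHR distribution is asymptotically optimal with respect to revenue, with $\mathrm{APX}(F,n)=1+O(\ln\ln n/\ln n)$.
   Context: $F$ is the cdf of a continuous (absolutely continuous) probability distribution with pdf $f$, supported on an interval $D_F\subseteq[0,\infty)$. $F$ is MHR (monotone hazard rate) if $x\mapsto f(x)/(1-F(x))$ is nondecreasing on $D_F$; equivalently $\ln(1-F(x))$ is concave. For an integer $n\ge 2$ (number of bidders, with i.i.d. valuations from $F$) let $X_{n:n}$ be the maximum of $n$ i.i.d. draws from $F$, and let $\phi(x)=x-\frac{1-F(x)}{f(x)}$ be the virtual valuation. The optimal auction revenue is $\mathrm{Myerson}(F,n)=\mathbb{E}[\max\{0,\phi(X_{n:n})\}]$, and the optimal anonymous pricing revenue is $\mathrm{Price}(F,n)=\sup_{p\in D_F}p\,(1-F(p)^n)$. The approximation ratio is $\mathrm{APX}(F,n)=\mathrm{Myerson}(F,n)/\mathrm{Price}(F,n)$. *)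

theory Defs
  imports "HOL-Probability.Probability"
begin

definition dist_of :: "(real \<Rightarrow> real) \<Rightarrow> real measure" where
  "dist_of f = density lborel (\<lambda>x. ennreal (f x))"

text \<open>Nonnegativity of the density is explicit because \<^const>\<open>ennreal\<close> would silently truncate
  negative values.\<close>

definition continuous_distribution :: "real set \<Rightarrow> (real \<Rightarrow> real) \<Rightarrow> bool" where
  "continuous_distribution D f \<longleftrightarrow>
     f \<in> borel_measurable borel \<and> (\<forall>x. 0 \<le> f x) \<and> prob_space (dist_of f) \<and>
     is_interval D \<and> D \<subseteq> {0..} \<and> (AE x in dist_of f. x \<in> D)"

abbreviation cdf_of :: "(real \<Rightarrow> real) \<Rightarrow> real \<Rightarrow> real" where
  "cdf_of f \<equiv> cdf (dist_of f)"

definition hazard_rate :: "(real \<Rightarrow> real) \<Rightarrow> real \<Rightarrow> real" where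
  "hazard_rate f x = f x / (1 - cdf_of f x)"

text \<open>Monotonicity is required only where \<open>F x < 1\<close>: at a right endpoint of \<open>D\<close> the hazard rate
  has denominator zero (it is infinite by convention, while HOL division would give \<open>0\<close>).\<close>

definition MHR :: "real set \<Rightarrow> (real \<Rightarrow> real) \<Rightarrow> bool" where
  "MHR D f \<longleftrightarrow> mono_on {x \<in> D. cdf_of f x < 1} (hazard_rate f)"

definition virtual_valuation :: "(real \<Rightarrow> real) \<Rightarrow> real \<Rightarrow> real" where
  "virtual_valuation f x = x - (1 - cdf_of f x) / f x"

text \<open>The expectation is over \<open>n\<close> independent draws, i.e. over the \<open>n\<close>-fold product measure.
  The points where \<open>f x = 0\<close>, at which HOL division is a convention, form a null set of
  \<open>dist_of f\<close>. Under MHR the distribution has a finite mean, so the integrand is integrable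
  and the set of prices' revenues below is bounded above.\<close>

definition Myerson :: "(real \<Rightarrow> real) \<Rightarrow> nat \<Rightarrow> real" where
  "Myerson f n =
     (\<integral>v. max 0 (virtual_valuation f (Max (v ` {..<n}))) \<partial>(\<Pi>\<^sub>M i\<in>{..<n}. dist_of f))"

definition Price :: "real set \<Rightarrow> (real \<Rightarrow> real) \<Rightarrow> nat \<Rightarrow> real" where
  "Price D f n = (SUP p\<in>D. p * (1 - cdf_of f p ^ n))"

definition APX :: "real set \<Rightarrow> (real \<Rightarrow> real) \<Rightarrow> nat \<Rightarrow> real" where
  "APX D f n = Myerson f n / Price D f n"

end

theory Submission
  imports Defs
begin

text \<open>Let \<open>G = 1 - F\<close> and post a price \<open>p\<close> with \<open>G p = L / n\<close>, where \<open>L = ln (ln n)\<close>. It is refused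
  by everybody with probability at most \<open>exp (- L) = 1 / ln n\<close>, so \<open>Price \<ge> p * (1 - 1 / ln n)\<close>.
  Conversely the virtual valuation is at most the value, hence \<open>Myerson\<close> is at most
  \<open>p\<close> plus \<open>n\<close> times the mean excess of a single value over \<open>p\<close>. If \<open>r\<close> denotes the hazard rate
  at \<open>p\<close>, monotonicity gives \<open>f \<ge> r * G\<close> above \<open>p\<close>, so that this mean excess \<open>\<integral>\<^sub>p G\<close>
  is at most \<open>G p / r\<close>, and \<open>f \<le> r * G\<close> below \<open>p\<close>, so that \<open>exp (- r * p) \<le> G p\<close>.
  Therefore \<open>Myerson \<le> p * (1 + L / ln (n / L))\<close>.\<close>

section \<open>Mean excess over a price and the maximum of independent draws\<close>

text \<open>Tonelli applied to the indicator of \<open>p <= t < x\<close>: integrating out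
  \<open>t\<close> first gives the excess, integrating out \<open>x\<close> first gives the tail
  probability.\<close>

lemma (in real_distribution) nn_integral_excess:
  "(\<integral>\<^sup>+x. ennreal (max 0 (x - p)) \<partial>M) =
     (\<integral>\<^sup>+t. ennreal (1 - cdf M t) * indicator {p..} t \<partial>lborel)"
proof -
  interpret pair_sigma_finite M lborel ..
  have 1: "ennreal (max 0 (x - p)) = (\<integral>\<^sup>+t. (if p \<le> t \<and> t < x then 1 else 0) \<partial>lborel)" for x
  proof -
    have "(\<integral>\<^sup>+t. (if p \<le> t \<and> t < x then 1 else 0) \<partial>lborel) = (\<integral>\<^sup>+t. indicator {p..<x} t \<partial>lborel)"
      by (intro nn_integral_cong) (auto simp: indicator_def)
    also have "\<dots> = emeasure lborel {p..<x}" by simp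
    also have "\<dots> = ennreal (max 0 (x - p))"
      by (cases "p \<le> x") auto
    finally show ?thesis by simp
  qed
  have 2: "(\<integral>\<^sup>+x. (if p \<le> t \<and> t < x then 1 else 0) \<partial>M) = ennreal (1 - cdf M t) * indicator {p..} t"
    for t
  proof -
    have "(\<integral>\<^sup>+x. (if p \<le> t \<and> t < x then 1 else 0) \<partial>M) = (\<integral>\<^sup>+x. indicator {p..} t * indicator {t<..} x \<partial>M)"
      by (intro nn_integral_cong) (auto simp: indicator_def)
    also have "\<dots> = indicator {p..} t * emeasure M {t<..}"
      by (subst nn_integral_cmult) auto
    also have "emeasure M {t<..} = ennreal (1 - cdf M t)"
      using prob_compl[of "{..t}"] by (simp add: emeasure_eq_measure cdf_def Compl_eq_Diff_UNIV[symmetric])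
    finally show ?thesis by (simp add: mult.commute)
  qed
  have "(\<integral>\<^sup>+x. \<integral>\<^sup>+t. (if p \<le> t \<and> t < x then 1 else 0) \<partial>lborel \<partial>M) =
      (\<integral>\<^sup>+t. \<integral>\<^sup>+x. (if p \<le> t \<and> t < x then 1 else 0) \<partial>M \<partial>lborel)"
    by (rule Fubini'[symmetric]) measurable
  then show ?thesis
    unfolding 1 2 .
qed

text \<open>Pointwise, the maximum is some \<open>v i\<close>, which is at most \<open>p\<close>
  plus its own excess, and that excess is at most the sum of all \<open>n\<close> excesses. Every
  coordinate has marginal \<open>M\<close>.\<close>

lemma nn_integral_Max_le:
  fixes M :: "real measure"
  assumes "real_distribution M" "0 \<le> p" "0 < n"
  shows "(\<integral>\<^sup>+v. ennreal (max 0 (Max (v ` {..<n}))) \<partial>(\<Pi>\<^sub>M i\<in>{..<n}. M))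
           \<le> ennreal p + of_nat n * (\<integral>\<^sup>+x. ennreal (max 0 (x - p)) \<partial>M)"
proof -
  interpret real_distribution M by fact
  interpret P: product_prob_space "\<lambda>_. M" "{..<n}" ..
  let ?P = "\<Pi>\<^sub>M i\<in>{..<n}. M"
  have le: "ennreal (max 0 (Max (v ` {..<n}))) \<le> ennreal p + (\<Sum>i<n. ennreal (max 0 (v i - p)))" for v
  proof -
    have "Max (v ` {..<n}) \<in> v ` {..<n}"
      using \<open>0 < n\<close> by (intro Max_in) auto
    then obtain i where i: "i < n" "Max (v ` {..<n}) = v i" by auto
    have "max 0 (v i) \<le> p + max 0 (v i - p)" using \<open>0 \<le> p\<close> by auto
    also have "max 0 (v i - p) \<le> (\<Sum>i<n. max 0 (v i - p))"
      using i(1) by (intro member_le_sum) auto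
    finally have "ennreal (max 0 (v i)) \<le> ennreal (p + (\<Sum>i<n. max 0 (v i - p)))"
      by (intro ennreal_leI) auto
    also have "\<dots> = ennreal p + (\<Sum>i<n. ennreal (max 0 (v i - p)))"
      using \<open>0 \<le> p\<close> by (simp add: ennreal_plus sum_nonneg flip: sum_ennreal)
    finally show ?thesis using i(2) by simp
  qed
  have "(\<integral>\<^sup>+v. ennreal (max 0 (v i - p)) \<partial>?P) = (\<integral>\<^sup>+x. ennreal (max 0 (x - p)) \<partial>M)" if "i < n" for i
  proof -
    have "(\<integral>\<^sup>+x. ennreal (max 0 (x - p)) \<partial>distr ?P M (\<lambda>v. v i)) = (\<integral>\<^sup>+v. ennreal (max 0 (v i - p)) \<partial>?P)"
      using that by (intro nn_integral_distr) auto
    then show ?thesis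
      using that by (subst (asm) distr_PiM_component) (auto intro: prob_space_axioms)
  qed
  moreover have "(\<integral>\<^sup>+v. ennreal p + (\<Sum>i<n. ennreal (max 0 (v i - p))) \<partial>?P)
      = ennreal p + (\<Sum>i<n. \<integral>\<^sup>+v. ennreal (max 0 (v i - p)) \<partial>?P)"
    by (subst nn_integral_add, measurable, subst nn_integral_sum)
       (auto simp: P.P.emeasure_space_1)
  ultimately show ?thesis
    using nn_integral_mono[of ?P "\<lambda>v. ennreal (max 0 (Max (v ` {..<n})))"
        "\<lambda>v. ennreal p + (\<Sum>i<n. ennreal (max 0 (v i - p)))", OF le]
    by simp
qed

section \<open>Support, continuity of the distribution function, and quantiles\<close>

locale mhr_distribution =
  fixes D :: "real set" and f :: "real \<Rightarrow> real"
  assumes continuous_distribution: "continuous_distribution D f"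
    and MHR: "MHR D f"
begin

lemma measurable_density [measurable]: "f \<in> borel_measurable borel"
  and pdf_nonneg: "0 \<le> f x"
  using continuous_distribution by (auto simp: continuous_distribution_def)

sublocale real_distribution "dist_of f"
  using continuous_distribution
  by (auto simp: continuous_distribution_def real_distribution_def real_distribution_axioms_def dist_of_def)

abbreviation "F \<equiv> cdf_of f"

lemma AE_support: "AE x in lborel. f x = 0 \<or> x \<in> D"
proof -
  have "AE x in dist_of f. x \<in> D"
    using continuous_distribution by (auto simp: continuous_distribution_def)
  then have "AE x in lborel. 0 < ennreal (f x) \<longrightarrow> x \<in> D"
    unfolding dist_of_def by (subst (asm) AE_density) auto
  then show ?thesis
    by eventually_elim (metis pdf_nonneg ennreal_less_zero_iff order_le_less)
qed

lemma support_nonneg: "x \<in> D \<Longrightarrow> 0 \<le> x"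
  using continuous_distribution by (auto simp: continuous_distribution_def)

lemma emeasure_eq: "A \<in> sets borel \<Longrightarrow> emeasure (dist_of f) A = (\<integral>\<^sup>+x. ennreal (f x) * indicator A x \<partial>lborel)"
  unfolding dist_of_def by (subst emeasure_density) auto

text \<open>The exceptional point \<open>a\<close> is Lebesgue-null. It is there for sets that may
  touch \<open>D\<close> at an endpoint, such as \<open>{..0}\<close>.\<close>

lemma emeasure_eq_0:
  assumes "A \<in> sets borel" "A \<inter> D \<subseteq> {a}"
  shows "emeasure (dist_of f) A = 0"
proof -
  have "AE x in lborel. ennreal (f x) * indicator A x = 0"
    using AE_support AE_lborel_singleton[of a]
    by eventually_elim (use assms(2) in \<open>auto simp: indicator_def\<close>)
  then show ?thesis
    using assms(1) by (subst emeasure_eq) (auto simp: nn_integral_0_iff_AE)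
qed

lemma isCont_F: "isCont F x"
proof -
  have "AE y in lborel. ennreal (f y) * indicator {x} y = 0"
    using AE_lborel_singleton[of x] by eventually_elim auto
  then have "emeasure (dist_of f) {x} = 0"
    by (subst emeasure_eq) (auto simp: nn_integral_0_iff_AE)
  then show ?thesis
    by (simp add: isCont_cdf measure_def)
qed

lemma F_eq_0: "{..x} \<inter> D \<subseteq> {a} \<Longrightarrow> F x = 0"
  using emeasure_eq_0[of "{..x}" a] by (simp add: cdf_def measure_def)

lemma F_eq_1:
  assumes "{x<..} \<inter> D = {}"
  shows "F x = 1"
proof -
  have "prob {x<..} = 0"
    using emeasure_eq_0[of "{x<..}" 0] assms by (simp add: measure_def)
  then show ?thesis
    using prob_compl[of "{..x}"] by (simp add: cdf_def Compl_eq_Diff_UNIV[symmetric])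
qed

text \<open>Positive mass on each side of \<open>p\<close> yields points of \<open>D\<close> on each
  side, and \<open>D\<close> is an interval.\<close>

lemma in_support:
  assumes "0 < F p" "F p < 1"
  shows "p \<in> D"
proof -
  have "is_interval D"
    using continuous_distribution by (simp add: continuous_distribution_def)
  moreover obtain a where "a \<in> D" "a \<le> p" using F_eq_0[of p 0] assms by auto
  moreover obtain b where "b \<in> D" "p < b" using F_eq_1[of p] assms by auto
  ultimately show ?thesis
    by (meson is_interval_1 less_imp_le)
qed

lemma F_at_0: "F 0 = 0"
  using support_nonneg by (intro F_eq_0[of _ 0]) force

lemma quantile:
  assumes "0 < y" "y < 1"
  obtains p where "0 < p" "F p = y" "p \<in> D"
proof -
  have "eventually (\<lambda>x. y < F x \<and> 0 < x) at_top"
    using order_tendstoD(1)[OF cdf_lim_at_top_prob assms(2)] eventually_gt_at_top[of 0]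
    by (rule eventually_conj)
  then obtain b where "y < F b" "0 < b"
    using eventually_happens by force
  then obtain p where p: "0 \<le> p" "F p = y"
    using IVT[of F 0 y b] F_at_0 assms isCont_F by auto
  moreover have "p \<noteq> 0" using p assms F_at_0 by auto
  moreover have "p \<in> D" using p assms by (intro in_support) auto
  ultimately show ?thesis using that[of p] by simp
qed

section \<open>Density, survival and excess bounds from the monotone hazard rate\<close>

lemma density_le:
  assumes "p \<in> D" "F p < 1" "x \<in> D" "x \<le> p"
  shows "f x \<le> hazard_rate f p * (1 - F x)"
proof -
  have "F x < 1" using cdf_nondecreasing[OF assms(4)] assms(2) by simp
  then have "hazard_rate f x \<le> hazard_rate f p"
    using MHR assms unfolding MHR_def by (auto dest: mono_onD)
  with \<open>F x < 1\<close> show ?thesis by (simp add: hazard_rate_def[of f x] field_simps)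
qed

lemma density_ge:
  assumes "p \<in> D" "F p < 1" "p \<le> x"
  shows "hazard_rate f p * (1 - F x) \<le> f x"
proof (cases "F x < 1")
  case True
  have "x \<in> D"
  proof (rule ccontr)
    assume "x \<notin> D"
    \<comment> \<open>A point of \<open>D\<close> beyond \<open>x\<close> would, together with
      \<open>p\<close>, enclose \<open>x\<close> in the interval \<open>D\<close>; hence no mass
      lies beyond \<open>x\<close>.\<close>
    have "F x = 1"
    proof (rule F_eq_1, rule ccontr)
      assume "{x<..} \<inter> D \<noteq> {}"
      then obtain b where "b \<in> D" "x < b" by auto
      moreover have "is_interval D"
        using continuous_distribution by (simp add: continuous_distribution_def)
      ultimately show False
        using assms \<open>x \<notin> D\<close> by (meson is_interval_1 less_imp_le)
    qed
    with True show False by simp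
  qed
  then have "hazard_rate f p \<le> hazard_rate f x"
    using MHR assms True unfolding MHR_def by (auto dest: mono_onD)
  with True show ?thesis by (simp add: hazard_rate_def[of f x] field_simps)
next
  case False
  then have "F x = 1" using cdf_bounded_prob[of x] by simp
  then show ?thesis using pdf_nonneg by simp
qed

lemma hazard_rate_nonneg: "0 \<le> hazard_rate f p"
  using cdf_bounded_prob[of p] pdf_nonneg[of p] by (simp add: hazard_rate_def)

text \<open>One Euler step for \<open>G' >= - r * G\<close> with \<open>G = 1 - F\<close>: on
  \<open>{s<..t}\<close> the density is almost everywhere at most \<open>r * G s\<close>, because
  \<open>G\<close> is nonincreasing; integrate over length \<open>t - s\<close>.\<close>

lemma survival_step:
  assumes "p \<in> D" "F p < 1" "s \<le> t" "t \<le> p"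
  shows "(1 - F s) * (1 - hazard_rate f p * (t - s)) \<le> 1 - F t"
proof -
  define c where "c = hazard_rate f p * (1 - F s)"
  have "0 \<le> c"
    using hazard_rate_nonneg cdf_bounded_prob by (simp add: c_def)
  have "AE x in lborel. ennreal (f x) * indicator {s<..t} x \<le> ennreal c * indicator {s<..t} x"
    using AE_support
  proof eventually_elim
    case (elim x)
    have "f x \<le> c" if "s < x" "x \<le> t"
    proof (cases "f x = 0")
      case False
      then have "f x \<le> hazard_rate f p * (1 - F x)"
        using elim assms that by (intro density_le) auto
      also have "\<dots> \<le> c"
        unfolding c_def using that hazard_rate_nonneg cdf_nondecreasing[of s x]
        by (intro mult_left_mono) auto
      finally show ?thesis .
    qed (use \<open>0 \<le> c\<close> in simp)
    then show ?case by (auto simp: indicator_def intro: ennreal_leI)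
  qed
  then have "emeasure (dist_of f) {s<..t} \<le> (\<integral>\<^sup>+x. ennreal c * indicator {s<..t} x \<partial>lborel)"
    by (subst emeasure_eq) (auto intro: nn_integral_mono_AE)
  also have "\<dots> = ennreal (c * (t - s))"
    using assms \<open>0 \<le> c\<close> by (simp add: nn_integral_cmult ennreal_mult)
  finally have "prob {s<..t} \<le> c * (t - s)"
    using assms \<open>0 \<le> c\<close> by (simp add: emeasure_eq_measure)
  moreover have "prob {s<..t} = F t - F s"
    using assms by (cases "s = t") (auto simp: cdf_diff_eq)
  ultimately show ?thesis by (simp add: c_def algebra_simps)
qed

text \<open>The discrete Gronwall iteration over \<open>k\<close> equal steps needs no differentiability of \<open>F\<close>.\<close>

lemma survival_ge_exp:
  assumes "p \<in> D" "F p < 1"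
  shows "exp (- (hazard_rate f p * p)) \<le> 1 - F p"
proof -
  define r where "r = hazard_rate f p"
  have p: "0 \<le> p" using assms support_nonneg by simp
  \<comment> \<open>Taking \<open>k > r * p\<close> keeps each factor \<open>1 - r * p / k\<close>
    nonnegative, so the induction may multiply by it.\<close>
  have "(1 + - (r * p) / real k) ^ k \<le> 1 - F p" if k: "r * p < real k" for k
  proof -
    have k0: "0 < real k"
      using k p hazard_rate_nonneg[of p] by (smt (verit) r_def mult_nonneg_nonneg)
    have q0: "0 \<le> 1 - r * p / real k" using k k0 by simp
    have "(1 - r * p / real k) ^ j \<le> 1 - F (real j * p / real k)" if "j \<le> k" for j
      using that
    proof (induction j)
      case 0
      then show ?case using F_at_0 by simp
    next
      case (Suc j)
      have "(1 - r * p / real k) ^ Suc j \<le> (1 - F (real j * p / real k)) * (1 - r * p / real k)"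
        using mult_right_mono[OF Suc.IH q0] Suc.prems by (simp add: mult.commute)
      also have "\<dots> = (1 - F (real j * p / real k)) *
          (1 - r * (real (Suc j) * p / real k - real j * p / real k))"
        using k0 by (simp add: field_simps)
      also have "\<dots> \<le> 1 - F (real (Suc j) * p / real k)"
      proof (unfold r_def, rule survival_step[OF assms])
        show "real j * p / real k \<le> real (Suc j) * p / real k"
          using p k0 by (intro divide_right_mono mult_right_mono) auto
        have "real (Suc j) * p \<le> real k * p"
          using Suc.prems p by (intro mult_right_mono) auto
        then show "real (Suc j) * p / real k \<le> p"
          using k0 by (simp add: field_simps)
      qed
      finally show ?case .
    qed
    from this[of k] show ?thesis using k0 by simp
  qed
  then have "eventually (\<lambda>k. (1 + - (r * p) / real k) ^ k \<le> 1 - F p) sequentially"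
    by (intro eventually_mono[OF filterlim_at_top_dense[THEN iffD1, rule_format, OF filterlim_real_sequentially]])
  from tendsto_upperbound[OF tendsto_exp_limit_sequentially this] show ?thesis
    by (simp add: r_def)
qed

text \<open>Above \<open>p\<close> the survival function is at most \<open>f / r\<close>, so its
  integral is at most \<open>1 / r\<close> times the mass of \<open>{p..}\<close>.\<close>

lemma excess_le:
  assumes "p \<in> D" "F p < 1" "0 < hazard_rate f p"
  shows "(\<integral>\<^sup>+x. ennreal (max 0 (x - p)) \<partial>dist_of f) \<le> ennreal ((1 - F p) / hazard_rate f p)"
proof -
  define r where "r = hazard_rate f p"
  have r: "0 < r" using assms by (simp add: r_def)
  have "(\<integral>\<^sup>+x. ennreal (max 0 (x - p)) \<partial>dist_of f)
      \<le> (\<integral>\<^sup>+x. ennreal (1 / r) * (ennreal (f x) * indicator {p..} x) \<partial>lborel)"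
    unfolding nn_integral_excess
  proof (intro nn_integral_mono)
    fix x
    show "ennreal (1 - F x) * indicator {p..} x \<le> ennreal (1 / r) * (ennreal (f x) * indicator {p..} x)"
    proof (cases "p \<le> x")
      case True
      then have "1 - F x \<le> 1 / r * f x"
        using density_ge[OF assms(1,2) True] r by (simp add: r_def field_simps)
      then have "ennreal (1 - F x) \<le> ennreal (1 / r) * ennreal (f x)"
        using r pdf_nonneg by (subst ennreal_mult[symmetric]) (auto intro: ennreal_leI)
      then show ?thesis using True by simp
    qed simp
  qed
  also have "\<dots> = ennreal (1 / r) * emeasure (dist_of f) {p..}"
    by (subst nn_integral_cmult) (auto simp: emeasure_eq)
  also have "emeasure (dist_of f) {p..} = ennreal (1 - F p)"
  proof -
    have "prob {p} = 0" using isCont_F isCont_cdf by simp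
    moreover have "{p..} = {p} \<union> {p<..}" by auto
    then have "prob {p..} = prob {p} + prob {p<..}"
      by (simp only:) (intro finite_measure_Union, auto)
    ultimately have "prob {p..} = prob {p<..}" by simp
    also have "\<dots> = 1 - F p"
      using prob_compl[of "{..p}"] by (simp add: cdf_def Compl_eq_Diff_UNIV[symmetric])
    finally show ?thesis by (simp add: emeasure_eq_measure)
  qed
  finally show ?thesis
    using r cdf_bounded_prob[of p] by (simp add: r_def ennreal_mult[symmetric])
qed

section \<open>Bounds on the two revenues and their ratio\<close>

lemma Myerson_le:
  assumes "p \<in> D" "F p < 1" "0 < hazard_rate f p" "0 < n"
  shows "Myerson f n \<le> p + real n * ((1 - F p) / hazard_rate f p)"
proof -
  have p: "0 \<le> p" using assms support_nonneg by simp
  have G: "0 \<le> (1 - F p) / hazard_rate f p" using assms by simp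
  have "virtual_valuation f x \<le> x" for x
    using cdf_bounded_prob[of x] pdf_nonneg[of x] by (simp add: virtual_valuation_def)
  then have "(\<integral>\<^sup>+v. ennreal (max 0 (virtual_valuation f (Max (v ` {..<n})))) \<partial>(\<Pi>\<^sub>M i\<in>{..<n}. dist_of f))
      \<le> (\<integral>\<^sup>+v. ennreal (max 0 (Max (v ` {..<n}))) \<partial>(\<Pi>\<^sub>M i\<in>{..<n}. dist_of f))"
    by (intro nn_integral_mono ennreal_leI max.mono) auto
  also have "\<dots> \<le> ennreal p + of_nat n * (\<integral>\<^sup>+x. ennreal (max 0 (x - p)) \<partial>dist_of f)"
    using p assms by (intro nn_integral_Max_le real_distribution_axioms) auto
  also have "\<dots> \<le> ennreal p + of_nat n * ennreal ((1 - F p) / hazard_rate f p)"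
    using assms by (intro add_left_mono mult_left_mono excess_le) auto
  also have "\<dots> = ennreal (p + real n * ((1 - F p) / hazard_rate f p))"
    using p G by (simp add: ennreal_plus ennreal_mult ennreal_of_nat_eq_real_of_nat del: times_divide_eq_right)
  \<comment> \<open>The bound on the nonnegative integral passes to the Bochner integral, which is 0
    in the non-integrable case, since the right-hand side is nonnegative.\<close>
  finally show ?thesis
    unfolding Myerson_def using p G by (intro integral_real_bounded add_nonneg_nonneg mult_nonneg_nonneg) auto
qed

text \<open>The supremum defining \<open>Price\<close> would be a junk value if the revenues were unbounded.\<close>

lemma bdd_above_revenue:
  assumes "p \<in> D" "F p < 1" "0 < hazard_rate f p"
  shows "bdd_above ((\<lambda>q. q * (1 - F q ^ n)) ` D)"
proof (rule bdd_aboveI2)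
  fix q assume "q \<in> D"
  then have q: "0 \<le> q" by (rule support_nonneg)
  have p: "0 \<le> p" using assms support_nonneg by simp
  have F: "0 \<le> F q" "F q \<le> 1" using cdf_nonneg cdf_bounded_prob by auto
  \<comment> \<open>Bernoulli's inequality reduces the revenue from \<open>n\<close> buyers to
    \<open>n\<close> times that from one.\<close>
  have "1 + real n * (F q - 1) \<le> F q ^ n"
    using Bernoulli_inequality[of "F q - 1" n] F by simp
  then have "q * (1 - F q ^ n) \<le> q * (real n * (1 - F q))"
    using q by (intro mult_left_mono) (auto simp: algebra_simps)
  moreover have "q * (1 - F q) \<le> p + (1 - F p) / hazard_rate f p"
  proof (cases "p \<le> q")
    case True
    \<comment> \<open>Markov's inequality for the excess over \<open>p\<close>: beyond
      \<open>q\<close> the excess is at least \<open>q - p\<close>.\<close>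
    have "ennreal ((q - p) * (1 - F q)) = (\<integral>\<^sup>+x. ennreal (q - p) * indicator {q<..} x \<partial>dist_of f)"
      using True F prob_compl[of "{..q}"]
      by (simp add: nn_integral_cmult emeasure_eq_measure ennreal_mult cdf_def Compl_eq_Diff_UNIV[symmetric])
    also have "\<dots> \<le> (\<integral>\<^sup>+x. ennreal (max 0 (x - p)) \<partial>dist_of f)"
      by (intro nn_integral_mono) (auto simp: indicator_def intro: ennreal_leI)
    also have "\<dots> \<le> ennreal ((1 - F p) / hazard_rate f p)"
      using assms by (rule excess_le)
    finally have "(q - p) * (1 - F q) \<le> (1 - F p) / hazard_rate f p"
      using assms by (simp add: ennreal_le_iff)
    moreover have "p * (1 - F q) \<le> p" using p F by (simp add: mult_left_le)
    ultimately show ?thesis by (simp add: algebra_simps)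
  next
    case False
    have "q * (1 - F q) \<le> q" using q F by (simp add: mult_left_le)
    also have "\<dots> \<le> p + (1 - F p) / hazard_rate f p"
      using False divide_nonneg_pos[of "1 - F p" "hazard_rate f p"] assms by linarith
    finally show ?thesis .
  qed
  then have "real n * (q * (1 - F q)) \<le> real n * (p + (1 - F p) / hazard_rate f p)"
    by (intro mult_left_mono) auto
  ultimately show "q * (1 - F q ^ n) \<le> real n * (p + (1 - F p) / hazard_rate f p)"
    by (simp only: mult.left_commute)
qed

text \<open>Both revenue bounds are multiples of the price \<open>p\<close>, which cancels, so the
  result is uniform in the distribution. \<open>L\<close> is the expected number of buyers whose
  value exceeds \<open>p\<close>.\<close>

lemma APX_le:
  assumes "0 < L" "L < real n"
  shows "APX D f n \<le> (1 + L / ln (real n / L)) / (1 - exp (- L))"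
proof -
  obtain p where p: "0 < p" "F p = 1 - L / real n" "p \<in> D"
    using quantile[of "1 - L / real n"] assms by auto
  define r where "r = hazard_rate f p"
  have Fp: "F p < 1" and G: "1 - F p = L / real n" using p assms by auto
  have "exp (- (r * p)) \<le> L / real n"
    using survival_ge_exp[of p] p Fp by (simp add: r_def)
  \<comment> \<open>The exponential survival bound, read backwards, bounds \<open>r * p\<close> from
    below by \<open>ln (n / L)\<close>; this also makes \<open>r\<close> positive.\<close>
  then have "- (r * p) \<le> ln (L / real n)"
    using assms by (subst ln_ge_iff) auto
  then have rp: "ln (real n / L) \<le> r * p"
    using assms by (simp add: ln_div)
  have l: "0 < ln (real n / L)" using assms by (intro ln_gt_zero) auto
  with rp have r: "0 < r"
    using p(1) by (smt (verit) zero_less_mult_pos2)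
  have "Myerson f n \<le> p + L / r"
    using Myerson_le[of p n] p Fp r assms G by (simp add: r_def)
  also have "L / r \<le> p * (L / ln (real n / L))"
    using rp r l assms by (simp add: field_simps mult_left_mono)
  finally have M: "Myerson f n \<le> p * (1 + L / ln (real n / L))"
    by (simp add: algebra_simps)
  have "F p ^ n \<le> exp (- (L / real n)) ^ n"
    using exp_ge_add_one_self[of "- (L / real n)"] p(2) cdf_nonneg[of p]
    by (intro power_mono) auto
  also have "\<dots> = exp (- L)"
    using assms by (simp flip: exp_of_nat_mult)
  finally have "p * (1 - exp (- L)) \<le> p * (1 - F p ^ n)"
    using p by (intro mult_left_mono) auto
  also have "\<dots> \<le> Price D f n"
    unfolding Price_def
    using p Fp r by (intro cSUP_upper bdd_above_revenue[of p]) (auto simp: r_def)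
  finally have P: "p * (1 - exp (- L)) \<le> Price D f n" .
  have e: "0 < 1 - exp (- L)" using assms by simp
  have "APX D f n \<le> p * (1 + L / ln (real n / L)) / (p * (1 - exp (- L)))"
    unfolding APX_def using M P p e l assms
    by (intro frac_le) auto
  also have "\<dots> = (1 + L / ln (real n / L)) / (1 - exp (- L))"
    using p by simp
  finally show ?thesis .
qed

end

section \<open>Asymptotics in the number of buyers\<close>

lemma ln_le_half:
  fixes x :: real
  assumes "0 < x"
  shows "ln x \<le> x / 2"
proof -
  have "ln (x / 2) \<le> x / 2 - 1" using assms by (intro ln_le_minus_one) auto
  moreover have "ln 2 \<le> (1::real)" using ln_le_minus_one[of 2] by simp
  ultimately show ?thesis using assms by (simp add: ln_div)
qed

theorem theorem4p1:
  "\<exists>(C::real) > 0. \<exists>(n0::nat) \<ge> 3. \<forall>n \<ge> n0. \<forall>(D :: real set) (f :: real \<Rightarrow> real).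
     continuous_distribution D f \<longrightarrow> MHR D f \<longrightarrow>
     APX D f n \<le> 1 + C * (ln (ln (real n)) / ln (real n))"
proof -
  \<comment> \<open>For \<open>n > exp (exp 1)\<close> one has \<open>ln n > exp 1\<close> and hence
    \<open>L > 1\<close>; the added 1 gives the strict inequality.\<close>
  define n0 where "n0 = max 3 (nat \<lceil>exp (exp 1) + 1 :: real\<rceil>)"
  have "APX D f n \<le> 1 + 6 * (ln (ln (real n)) / ln (real n))"
    if n: "n0 \<le> n" and F: "continuous_distribution D f" "MHR D f" for n D f
  proof -
    interpret mhr_distribution D f by unfold_locales fact+
    define l where "l = ln (real n)"
    define L where "L = ln l"
    define u where "u = L / l"
    have n_gt: "exp (exp 1) < real n"
      using n unfolding n0_def by linarith
    then have "0 < real n" using order.strict_trans[OF exp_gt_zero] by blast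
    with n_gt have l: "exp 1 < l"
      unfolding l_def by (metis exp_less_cancel_iff exp_ln)
    then have l0: "0 < l" using order.strict_trans[OF exp_gt_zero] by blast
    with l have L: "1 < L"
      unfolding L_def by (metis exp_less_cancel_iff exp_ln)
    have "L \<le> l / 2" using l0 unfolding L_def by (rule ln_le_half)
    have "ln L \<le> L / 2" using L by (intro ln_le_half) simp
    have "ln (real n / L) = l - ln L"
      using L \<open>0 < real n\<close> by (simp add: ln_div l_def)
    \<comment> \<open>Here \<open>ln L\<close> is at most \<open>l / 4\<close>.\<close>
    with \<open>ln L \<le> L / 2\<close> \<open>L \<le> l / 2\<close> l0 have h: "l / 2 \<le> ln (real n / L)" by simp
    have "L < real n"
      using \<open>L \<le> l / 2\<close> l0 ln_le_half[OF \<open>0 < real n\<close>] \<open>0 < real n\<close> unfolding l_def by linarith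
    have u: "0 < u" "u \<le> 1 / 2"
      using L l0 \<open>L \<le> l / 2\<close> by (auto simp: u_def field_simps)
    have "exp (- L) = 1 / l" using l0 by (simp add: L_def exp_minus inverse_eq_divide)
    \<comment> \<open>\<open>L > 1\<close> lets \<open>u\<close> absorb the refusal probability
      \<open>1 / l\<close>.\<close>
    also have "\<dots> \<le> u" using L l0 by (simp add: u_def field_simps)
    finally have e: "exp (- L) \<le> u" .
    have "L / ln (real n / L) \<le> L / (l / 2)"
      using h L l0 by (intro divide_left_mono) auto
    then have b: "L / ln (real n / L) \<le> 2 * u" by (simp add: u_def mult.commute)
    have "APX D f n \<le> (1 + L / ln (real n / L)) / (1 - exp (- L))"
      using L \<open>L < real n\<close> by (intro APX_le) auto
    also have "\<dots> \<le> (1 + 2 * u) / (1 - u)"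
      using b e u by (intro frac_le) auto
    \<comment> \<open>After clearing the denominator this reads \<open>6 * u * u <= 3 * u\<close>,
      which is \<open>u <= 1 / 2\<close>; hence the constant 6.\<close>
    also have "\<dots> \<le> 1 + 6 * u"
    proof -
      have "u * u \<le> u * (1 / 2)" using u by (intro mult_left_mono) auto
      then have "1 + 2 * u \<le> (1 + 6 * u) * (1 - u)" by (simp add: algebra_simps)
      then show ?thesis using u by (simp add: pos_divide_le_eq)
    qed
    finally show ?thesis by (simp add: u_def L_def l_def)
  qed
  moreover have "3 \<le> n0" by (simp add: n0_def)
  ultimately show ?thesis
    by (intro exI[of _ 6] conjI exI[of _ n0]) auto
qed

end
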